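(* Let $c,b\ge 1$ be real constants and let $\Phi$ be an implicit set system. If $\Phi$ is $(b,c)$-uniform, then $|\mathcal{F}_I|\le\left(1+b-\frac{1}{c}\right)^{n}n^{O(1)}$ for every instance $I$, where $n=|U_I|$.
   Context: An implicit set system is a function $\Phi$ that takes as input a string $I\in\{0,1\}^*$ (an instance) and outputs a set system $(U_I,\mathcal{F}_I)$, where $U_I$ is a finite universe and $\mathcal{F}_I$ is a collection of subsets of $U_I$; $n=|U_I|$. For $X\subseteq U_I$ and an integer $k$, let $\mathcal{F}^k_{I,X}=\{S\subseteq U_I\setminus X: |S|=k \text{ and } S\cup X\in\mathcal{F}_I\}$. $\Phi$ is $(b,c)$-uniform if for every instance $I$, every $X\subseteq U_I$ and every integer $k\le n-|X|$, $|\mathcal{F}^k_{I,X}|\le b^{n-|X|}c^{k}n^{O(1)}$ (with the polynomial factor uniform over all $I,X,k$). *)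

theory Defs
  imports Complex_Main "HOL-Library.Landau_Symbols"
begin

type_synonym 'a set_system_fun = "bool list \<Rightarrow> 'a set \<times> 'a set set"

abbreviation universe :: "'a set_system_fun \<Rightarrow> bool list \<Rightarrow> 'a set" where
  "universe \<Phi> I \<equiv> fst (\<Phi> I)"

abbreviation family :: "'a set_system_fun \<Rightarrow> bool list \<Rightarrow> 'a set set" where
  "family \<Phi> I \<equiv> snd (\<Phi> I)"

definition implicit_set_system :: "'a set_system_fun \<Rightarrow> bool" where
  "implicit_set_system \<Phi> \<longleftrightarrow>
     (\<forall>I. finite (universe \<Phi> I) \<and> family \<Phi> I \<subseteq> Pow (universe \<Phi> I))"

definition extensions :: "'a set_system_fun \<Rightarrow> bool list \<Rightarrow> 'a set \<Rightarrow> int \<Rightarrow> 'a set set" where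
  "extensions \<Phi> I X k =
     {S. S \<subseteq> universe \<Phi> I - X \<and> int (card S) = k \<and> S \<union> X \<in> family \<Phi> I}"

text \<open>
  A factor $n^{O(1)}$ is a function of $n$ that is eventually bounded by a power of $n$ up to
  a constant. Its values at finitely many small $n$ are unconstrained: reading the factor as
  $n^d$ at every $n$ would force it to be $1$ at $n = 1$.
\<close>

definition poly_factor :: "(nat \<Rightarrow> real) \<Rightarrow> bool" where
  "poly_factor g \<longleftrightarrow> (\<exists>d::nat. g \<in> O(\<lambda>n. real n ^ d))"

text \<open>The factor is chosen before the instance, \<open>X\<close> and \<open>k\<close>, and depends on \<open>n\<close> only.\<close>

definition uniform :: "real \<Rightarrow> real \<Rightarrow> 'a set_system_fun \<Rightarrow> bool" where
  "uniform b c \<Phi> \<longleftrightarrow>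
     (\<exists>g. poly_factor g \<and>
       (\<forall>I X. X \<subseteq> universe \<Phi> I \<longrightarrow>
         (\<forall>k::int. k \<le> int (card (universe \<Phi> I)) - int (card X) \<longrightarrow>
           real (card (extensions \<Phi> I X k))
             \<le> b ^ (card (universe \<Phi> I) - card X) * c powi k * g (card (universe \<Phi> I)))))"

end

theory Submission
  imports Defs
begin

text \<open>
  Put \<open>\<beta> = 1 - 1 / c\<close> and give each pair \<open>(X, S)\<close> with \<open>X \<subseteq> S \<in> F\<close> the weight
  \<open>\<beta> ^ |X| * (1 / c) ^ |S - X|\<close>. Summed over \<open>X\<close> first, the binomial theorem yields
  \<open>(\<beta> + 1 / c) ^ |S| = 1\<close> for every \<open>S\<close>, so the total weight is \<open>|F|\<close>. Summed over \<open>S\<close> first,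
  the weight \<open>(1 / c) ^ k\<close> of the sets with \<open>|S - X| = k\<close> cancels the factor \<open>c ^ k\<close> of uniformity,
  so the total is at most \<open>(n + 1) * g n\<close> times the sum of \<open>\<beta> ^ |X| * b ^ (n - |X|)\<close> over
  \<open>X \<subseteq> U\<close>, which is \<open>(\<beta> + b) ^ n\<close>.
\<close>

text \<open>Expand the product over \<open>A\<close> of the factors \<open>x + y\<close>:
  \<open>X\<close> records the elements whose factor contributes \<open>x\<close>. The main proof
  uses this inside each member of the family and again on the whole universe.\<close>

lemma sum_Pow_power_card:
  fixes x y :: "'b::comm_semiring_1"
  assumes "finite A"
  shows "(\<Sum>X\<in>Pow A. x ^ card X * y ^ (card A - card X)) = (x + y) ^ card A"
proof -
  have "(x + y) ^ card A = (\<Prod>a\<in>A. x + y)"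
    by simp
  also have "\<dots> = (\<Sum>X\<in>Pow A. x ^ card X * y ^ card (A - X))"
    using assms by (subst prod_add) simp_all
  also have "\<dots> = (\<Sum>X\<in>Pow A. x ^ card X * y ^ (card A - card X))"
    using assms by (intro sum.cong) (auto simp: card_Diff_subset finite_subset)
  finally show ?thesis ..
qed

text \<open>The extra factor pays for summing over the at most \<open>n + 1\<close> possible sizes
  \<open>k\<close>.\<close>

lemma poly_factor_Suc_mult:
  assumes "poly_factor g"
  shows "poly_factor (\<lambda>n. (real n + 1) * g n)"
proof -
  obtain d where d: "g \<in> O(\<lambda>n. real n ^ d)"
    using assms by (auto simp: poly_factor_def)
  \<comment> \<open>The constant 2 works because \<open>n + 1 \<le> 2 * n\<close> once
    \<open>n \<ge> 1\<close>.\<close>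
  have "(\<lambda>n. real n + 1) \<in> O(\<lambda>n. real n)"
    by (intro bigoI[of _ 2] eventually_sequentiallyI[of 1]) simp
  from landau_o.big.mult[OF this d] show ?thesis
    unfolding poly_factor_def by (intro exI[of _ "Suc d"]) simp
qed

text \<open>Group the supersets of \<open>X\<close> by how many elements they add. Removing
  \<open>X\<close> is a bijection from each group onto the extensions of that size, with inverse
  \<open>S \<mapsto> S \<union> X\<close>.\<close>

lemma sum_card_eq_sum_extensions:
  fixes f :: "nat \<Rightarrow> real"
  assumes "finite (universe \<Phi> I)" and "family \<Phi> I \<subseteq> Pow (universe \<Phi> I)" and "X \<subseteq> universe \<Phi> I"
  shows "(\<Sum>S | S \<in> family \<Phi> I \<and> X \<subseteq> S. f (card S - card X))
    = (\<Sum>k\<le>card (universe \<Phi> I) - card X. real (card (extensions \<Phi> I X (int k))) * f k)"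
proof -
  let ?U = "universe \<Phi> I" and ?F = "{S \<in> family \<Phi> I. X \<subseteq> S}"
  have X: "finite X"
    using assms by (metis finite_subset)
  have F: "finite ?F"
    using assms by (metis (no_types, lifting) finite_Pow_iff finite_subset mem_Collect_eq subsetI)
  have fin: "finite S" if "S \<in> ?F" for S
    using that assms by (metis (no_types, lifting) PowD finite_subset mem_Collect_eq subsetD)
  have card_ext: "card {S \<in> ?F. card S - card X = k} = card (extensions \<Phi> I X (int k))" for k
  proof (rule bij_betw_same_card)
    show "bij_betw (\<lambda>S. S - X) {S \<in> ?F. card S - card X = k} (extensions \<Phi> I X (int k))"
    proof (rule bij_betw_byWitness[where f' = "\<lambda>S. S \<union> X"])
      show "(\<lambda>S. S - X) ` {S \<in> ?F. card S - card X = k} \<subseteq> extensions \<Phi> I X (int k)"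
        using assms X by (auto simp: extensions_def card_Diff_subset Un_absorb2)
      show "(\<lambda>S. S \<union> X) ` extensions \<Phi> I X (int k) \<subseteq> {S \<in> ?F. card S - card X = k}"
      proof (clarsimp simp: extensions_def)
        fix S assume S: "S \<subseteq> ?U - X"
        then have "finite S" "S \<inter> X = {}"
          using assms(1) finite_subset by blast+
        then show "card (S \<union> X) - card X = card S"
          using X by (simp add: card_Un_disjoint)
      qed
    qed (auto simp: extensions_def)
  qed
  have sub: "(\<lambda>S. card S - card X) ` ?F \<subseteq> {..card ?U - card X}"
    using assms by (auto intro!: diff_le_mono card_mono)
  have "(\<Sum>S\<in>?F. f (card S - card X))
      = (\<Sum>k\<le>card ?U - card X. \<Sum>S | S \<in> ?F \<and> card S - card X = k. f (card S - card X))"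
    by (rule sum.group[symmetric, OF F _ sub]) simp
  also have "\<dots> = (\<Sum>k\<le>card ?U - card X. real (card (extensions \<Phi> I X (int k))) * f k)"
    by (intro sum.cong refl) (simp flip: card_ext)
  finally show ?thesis .
qed

theorem theorem3:
  fixes b c :: real and \<Phi> :: "'a set_system_fun"
  assumes "c \<ge> 1" and "b \<ge> 1"
    and "implicit_set_system \<Phi>"
    and "uniform b c \<Phi>"
  shows "\<exists>g. poly_factor g \<and>
    (\<forall>I. real (card (family \<Phi> I))
           \<le> (1 + b - 1 / c) ^ card (universe \<Phi> I) * g (card (universe \<Phi> I)))"
proof -
  obtain g where "poly_factor g" and g: "\<And>I X k. \<lbrakk>X \<subseteq> universe \<Phi> I;
      k \<le> int (card (universe \<Phi> I)) - int (card X)\<rbrakk> \<Longrightarrow>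
      real (card (extensions \<Phi> I X k))
        \<le> b ^ (card (universe \<Phi> I) - card X) * c powi k * g (card (universe \<Phi> I))"
    using assms(4) unfolding uniform_def by blast
  define \<beta> where "\<beta> = 1 - 1 / c"
  have \<beta>: "\<beta> \<ge> 0" "\<beta> + 1 / c = 1" "\<beta> + b = 1 + b - 1 / c"
    using assms(1) by (auto simp: \<beta>_def)
  have "real (card (family \<Phi> I)) \<le> (1 + b - 1 / c) ^ card (universe \<Phi> I)
      * ((real (card (universe \<Phi> I)) + 1) * g (card (universe \<Phi> I)))" for I
  proof -
    let ?U = "universe \<Phi> I" and ?F = "family \<Phi> I"
    define n where "n = card ?U"
    have U: "finite ?U" and F: "?F \<subseteq> Pow ?U"
      using assms(3) by (auto simp: implicit_set_system_def)
    have finF: "finite ?F"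
      using U F by (meson finite_Pow_iff finite_subset)
    \<comment> \<open>No sign of \<open>g\<close> is given, but at \<open>X = ?U\<close> and
      \<open>k = 0\<close> both powers are 1, so \<open>g n\<close> bounds a cardinality.\<close>
    have "0 \<le> real (card (extensions \<Phi> I ?U 0))"
      by simp
    also have "\<dots> \<le> g n"
      using g[of ?U I 0] by (simp add: n_def)
    finally have g_nonneg: "0 \<le> g n" .
    have weight: "(\<Sum>S | S \<in> ?F \<and> X \<subseteq> S. (1 / c) ^ (card S - card X))
        \<le> b ^ (n - card X) * ((real n + 1) * g n)" if X: "X \<subseteq> ?U" for X
    proof -
      have "(\<Sum>S | S \<in> ?F \<and> X \<subseteq> S. (1 / c) ^ (card S - card X))
          = (\<Sum>k\<le>n - card X. real (card (extensions \<Phi> I X (int k))) * (1 / c) ^ k)"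
        unfolding n_def using U F X by (rule sum_card_eq_sum_extensions)
      also have "\<dots> \<le> (\<Sum>k\<le>n - card X. b ^ (n - card X) * g n)"
      proof (rule sum_mono)
        fix k assume "k \<in> {..n - card X}"
        \<comment> \<open>Since \<open>card X \<le> n\<close>, the truncated subtraction on naturals
          agrees with the integer one in the uniformity bound.\<close>
        then have "int k \<le> int n - int (card X)"
          using card_mono[OF U X] by (simp add: n_def)
        then have "real (card (extensions \<Phi> I X (int k))) \<le> b ^ (n - card X) * c ^ k * g n"
          using g[OF X, of "int k"] by (simp add: n_def)
        then have "real (card (extensions \<Phi> I X (int k))) * (1 / c) ^ k
            \<le> b ^ (n - card X) * c ^ k * g n * (1 / c) ^ k"
          using assms(1) by (intro mult_right_mono) auto
        also have "\<dots> = b ^ (n - card X) * g n"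
          using assms(1) by (simp add: power_one_over)
        finally show "real (card (extensions \<Phi> I X (int k))) * (1 / c) ^ k
            \<le> b ^ (n - card X) * g n" .
      qed
      also have "\<dots> = b ^ (n - card X) * ((real (n - card X) + 1) * g n)"
        by (simp add: algebra_simps)
      \<comment> \<open>Enlarging the number of sizes to \<open>n + 1\<close> makes the last factor
        independent of \<open>X\<close>, so that it can leave the sum over \<open>X\<close>.\<close>
      also have "\<dots> \<le> b ^ (n - card X) * ((real n + 1) * g n)"
        using assms(2) g_nonneg by (intro mult_left_mono mult_right_mono) auto
      finally show ?thesis .
    qed
    have "real (card ?F) = (\<Sum>S\<in>?F. (\<beta> + 1 / c) ^ card S)"
      by (simp add: \<beta>(2))
    also have "\<dots> = (\<Sum>S\<in>?F. \<Sum>X\<in>Pow S. \<beta> ^ card X * (1 / c) ^ (card S - card X))"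
      using F U by (intro sum.cong refl sum_Pow_power_card[symmetric]) (auto intro: finite_subset)
    \<comment> \<open>Letting \<open>X\<close> range over a set that does not depend on
      \<open>S\<close> prepares the exchange of the two sums.\<close>
    also have "\<dots> = (\<Sum>S\<in>?F. \<Sum>X | X \<in> Pow ?U \<and> X \<subseteq> S. \<beta> ^ card X * (1 / c) ^ (card S - card X))"
      using F by (intro sum.cong refl) auto
    also have "\<dots> = (\<Sum>X\<in>Pow ?U. \<Sum>S | S \<in> ?F \<and> X \<subseteq> S. \<beta> ^ card X * (1 / c) ^ (card S - card X))"
      using finF U by (intro sum.swap_restrict) auto
    \<comment> \<open>Here \<open>c \<ge> 1\<close> enters through \<open>\<beta> \<ge> 0\<close>:
      the bound for each \<open>X\<close> is multiplied by a power of \<beta>.\<close>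
    also have "\<dots> \<le> (\<Sum>X\<in>Pow ?U. \<beta> ^ card X * (b ^ (n - card X) * ((real n + 1) * g n)))"
      unfolding sum_distrib_left[symmetric]
      using weight \<beta>(1) by (intro sum_mono mult_left_mono) auto
    also have "\<dots> = (\<Sum>X\<in>Pow ?U. \<beta> ^ card X * b ^ (card ?U - card X)) * ((real n + 1) * g n)"
      by (simp add: sum_distrib_right mult.assoc n_def)
    also have "\<dots> = (1 + b - 1 / c) ^ n * ((real n + 1) * g n)"
      by (simp only: sum_Pow_power_card[OF U] \<beta>(3) n_def)
    finally show ?thesis
      unfolding n_def .
  qed
  with poly_factor_Suc_mult[OF \<open>poly_factor g\<close>] show ?thesis
    by blast
qed

end
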